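(* Let $m,d\ge1$ be integers such that $\nu:=m/d\in(0,3]$. Then $$\inf_L\sup_D\mathfrak R_m(L,D)\ \ge\ \hat B_2(\nu):=\begin{cases}B_1(\nu)=\frac12(1-\nu)&\text{if }0<\nu\le\frac12,\\[3pt]B_1(\nu)=\dfrac1{8\nu}&\text{if }\frac12\le\nu\le1,\\[6pt]\dfrac{(17-2\nu)\left(57187-3253\nu-138\nu^2+212\nu^3-8\nu^4\right)}{6480000}&\text{if }1\le\nu\le3,\end{cases}$$ where $\inf_L$ is either $\inf_{L\in\mathcal L}$ or $\inf_{L\in\mathcal L_{\mathsf{rand}}}$ (the inequality holds in both cases), and $\sup_D$ is over all probability distributions $D$ on $[d]\times\{-1,1\}$. (The first two cases include the assertion that $B_1(\nu)$ has the indicated value.)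
   Context: Setting: $\mathcal X=[d]=\{1,\dots,d\}$, $\mathcal Y=\{-1,1\}$, $\mathcal H=\mathcal Y^{\mathcal X}$. For a probability distribution $D$ on $\mathcal X\times\mathcal Y$, $(X^D,Y^D)$ is a random pair with distribution $D$, and $Z_m^D$ is the sequence of $m$ independent copies of it. Put $\operatorname{err}(h,D)=\mathsf P(h(X^D)\ne Y^D)$ and $\Delta(h,D)=\operatorname{err}(h,D)-\min_{g\in\mathcal H}\operatorname{err}(g,D)$. $\mathcal L$ is the set of all (non-randomized) learning algorithms, i.e. maps $L\colon(\mathcal X\times\mathcal Y)^m\to\mathcal H$; $\mathcal L_{\mathsf{rand}}$ is the set of all randomized learning algorithms, i.e. maps $L\colon(\mathcal X\times\mathcal Y)^m\times[-1,1]\to\mathcal H$ (measurable in the last argument). The expected excess risk is $\mathfrak R_m(L,D):=\mathsf E\,\Delta(L(Z_m^D),D)$ for $L\in\mathcal L$ and $\mathfrak R_m(L,D):=\mathsf E\,\Delta(L(Z_m^D,U),D)$ for $L\in\mathcal L_{\mathsf{rand}}$, with $U$ uniform on $[-1,1]$ and independent of $Z_m^D$. For $k\in\{0,1,\dots\}$ and $b\in[-1,1]$: $V^b_k:=Y^b_1+\dots+Y^b_k$, where the $Y^b_i$ are iid with $\mathsf P(Y^b_i=1)=\frac{1+b}2$, $\mathsf P(Y^b_i=-1)=\frac{1-b}2$ (so $V^b_0=0$); $s_k(b):=|\mathsf P(V^b_k>0)-\mathsf P(V^{-b}_k>0)|$; $\operatorname{bayes}(k,b):=\frac12\big(1-s_k(b)\big)$.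 For $b\in[0,1]$, $\kappa\mapsto\check{\operatorname{bayes}}(\kappa,b)$ on $[0,\infty)$ is the linear interpolation of $k\mapsto\operatorname{bayes}(k,b)$ at the points $0,1,3,5,\dots$: it equals $(1-\kappa)\operatorname{bayes}(0,b)+\kappa\operatorname{bayes}(1,b)$ for $0\le\kappa\le1$ and $\frac{2i+3-\kappa}2\operatorname{bayes}(2i+1,b)+\frac{\kappa-2i-1}2\operatorname{bayes}(2i+3,b)$ for $2i+1\le\kappa\le2i+3$, $i=0,1,\dots$. Finally, $B_1(\nu):=\sup_{b\in(0,1)}b\,\check{\operatorname{bayes}}(\nu,b)$. *)

theory Defs
  imports "HOL-Probability.Probability"
begin

definition labels :: "int set" where
  "labels = {-1, 1}"

definition hyps :: "nat \<Rightarrow> (nat \<Rightarrow> int) set" where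
  "hyps d = ({1..d} \<rightarrow>\<^sub>E labels)"

text \<open>The probability distributions on \<open>[d] \<times> {-1, 1}\<close>; as this set is finite, they are exactly
  the \<open>pmf\<close>s supported in it.\<close>

definition distrs :: "nat \<Rightarrow> (nat \<times> int) pmf set" where
  "distrs d = {D. set_pmf D \<subseteq> {1..d} \<times> labels}"

definition err :: "(nat \<Rightarrow> int) \<Rightarrow> (nat \<times> int) pmf \<Rightarrow> real" where
  "err h D = measure_pmf.prob D {(x, y). h x \<noteq> y}"

definition excess :: "nat \<Rightarrow> (nat \<Rightarrow> int) \<Rightarrow> (nat \<times> int) pmf \<Rightarrow> real" where
  "excess d h D = err h D - (MIN g\<in>hyps d. err g D)"

definition samples :: "nat \<Rightarrow> nat \<Rightarrow> (nat \<times> int) list set" where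
  "samples m d = {z. length z = m \<and> set z \<subseteq> {1..d} \<times> labels}"

text \<open>The law of \<open>Z\<^sub>m\<^sup>D\<close> is \<open>replicate_pmf m D\<close>, the distribution of a list of \<open>m\<close> independent
  draws from \<open>D\<close>. Values of a learner outside \<open>samples m d\<close> are irrelevant.\<close>

definition learners :: "nat \<Rightarrow> nat \<Rightarrow> ((nat \<times> int) list \<Rightarrow> nat \<Rightarrow> int) set" where
  "learners m d = (samples m d \<rightarrow> hyps d)"

definition risk :: "nat \<Rightarrow> nat \<Rightarrow> ((nat \<times> int) list \<Rightarrow> nat \<Rightarrow> int) \<Rightarrow> (nat \<times> int) pmf \<Rightarrow> real" where
  "risk m d L D = measure_pmf.expectation (replicate_pmf m D) (\<lambda>z. excess d (L z) D)"

definition unif :: "real measure" where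
  "unif = uniform_measure (restrict_space lborel {-1..1}) {-1..1}"

definition rand_learners :: "nat \<Rightarrow> nat \<Rightarrow> ((nat \<times> int) list \<Rightarrow> real \<Rightarrow> nat \<Rightarrow> int) set" where
  "rand_learners m d = {L. \<forall>z\<in>samples m d. L z \<in> unif \<rightarrow>\<^sub>M count_space (hyps d)}"

text \<open>The pair \<open>(Z\<^sub>m\<^sup>D, U)\<close> has the product law. The law of the sample is restricted to
  \<open>samples m d\<close>, which has full mass for \<open>D \<in> distrs d\<close>: learners need not be measurable
  elsewhere, and the integral of a non-measurable function would be \<open>0\<close> by convention.\<close>

definition rand_risk ::
  "nat \<Rightarrow> nat \<Rightarrow> ((nat \<times> int) list \<Rightarrow> real \<Rightarrow> nat \<Rightarrow> int) \<Rightarrow> (nat \<times> int) pmf \<Rightarrow> real" where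
  "rand_risk m d L D =
     (LINT (z, u) | (restrict_space (measure_pmf (replicate_pmf m D)) (samples m d) \<Otimes>\<^sub>M unif).
        excess d (L z u) D)"

text \<open>For \<open>d \<ge> 1\<close> both risks take values in \<open>[0, 1]\<close> and the index sets are nonempty, so the
  conditionally complete \<open>INF\<close> and \<open>SUP\<close> on \<open>real\<close> are the genuine ones.\<close>

definition minimax :: "nat \<Rightarrow> nat \<Rightarrow> real" where
  "minimax m d = (INF L\<in>learners m d. SUP D\<in>distrs d. risk m d L D)"

definition rand_minimax :: "nat \<Rightarrow> nat \<Rightarrow> real" where
  "rand_minimax m d = (INF L\<in>rand_learners m d. SUP D\<in>distrs d. rand_risk m d L D)"

definition Y_pmf :: "real \<Rightarrow> int pmf" where
  "Y_pmf b = map_pmf (\<lambda>c. if c then 1 else -1) (bernoulli_pmf ((1 + b) / 2))"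

definition V_pmf :: "nat \<Rightarrow> real \<Rightarrow> int pmf" where
  "V_pmf k b = map_pmf sum_list (replicate_pmf k (Y_pmf b))"

definition sep :: "nat \<Rightarrow> real \<Rightarrow> real" where
  "sep k b = \<bar>measure_pmf.prob (V_pmf k b) {0<..} - measure_pmf.prob (V_pmf k (-b)) {0<..}\<bar>"

definition bayes :: "nat \<Rightarrow> real \<Rightarrow> real" where
  "bayes k b = (1 - sep k b) / 2"

text \<open>The linear interpolation of \<open>bayes\<close> at the points \<open>0, 1, 3, 5, \<dots>\<close>. For \<open>\<kappa> \<ge> 1\<close> the index
  \<open>i\<close> is the one with \<open>2 i + 1 \<le> \<kappa> < 2 i + 3\<close>.\<close>

definition bayes_interp :: "real \<Rightarrow> real \<Rightarrow> real" where
  "bayes_interp \<kappa> b =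
     (if \<kappa> \<le> 1 then (1 - \<kappa>) * bayes 0 b + \<kappa> * bayes 1 b
      else let i = nat \<lfloor>(\<kappa> - 1) / 2\<rfloor> in
        (2 * real i + 3 - \<kappa>) / 2 * bayes (2 * i + 1) b
        + (\<kappa> - 2 * real i - 1) / 2 * bayes (2 * i + 3) b)"

definition B1 :: "real \<Rightarrow> real" where
  "B1 \<nu> = (SUP b\<in>{0<..<1}. b * bayes_interp \<nu> b)"

text \<open>Only used for \<open>0 < \<nu> \<le> 3\<close>. At \<open>\<nu> = 1\<close> the polynomial equals \<open>1 / 8 = 1 / (8 \<nu>)\<close>.\<close>

definition B2_hat :: "real \<Rightarrow> real" where
  "B2_hat \<nu> =
     (if \<nu> \<le> 1 then B1 \<nu>
      else (17 - 2 * \<nu>) * (57187 - 3253 * \<nu> - 138 * \<nu>^2 + 212 * \<nu>^3 - 8 * \<nu>^4) / 6480000)"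

end

theory Submission
  imports Defs
begin

text \<open>Bayes risk under a random labelling: let \<open>x\<close> be uniform on \<open>[d]\<close> and let the label of \<open>x\<close> be
  \<open>\<sigma> x\<close> with probability \<open>(1 + b) / 2\<close>, where the signs \<open>\<sigma> x\<close> are themselves drawn uniformly. The
  supremum over \<open>D\<close> is at least the average over \<open>\<sigma>\<close>. Pairing \<open>\<sigma>\<close> with its flip at \<open>x\<close>, no learner
  does better at \<open>x\<close> than the majority vote of the labels observed there, whose margin \<open>s\<^sub>N(b)\<close> depends
  on the number \<open>N\<close> of observations of \<open>x\<close>. Since \<open>N\<close> has mean \<open>m / d\<close>, any affine majorant
  \<open>\<alpha> + \<beta> k\<close> of \<open>s\<^sub>k(b)\<close> gives the bound \<open>b (1 - \<alpha> - \<beta> \<nu>) / 2\<close>. The line through \<open>k = 0, 1\<close> yields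
  \<open>B\<^sub>1(\<nu>)\<close> for \<open>\<nu> \<le> 1\<close>; the line through \<open>k = 1, 3\<close> with \<open>b = (17 - 2 \<nu>) / 30\<close>, the linear
  interpolation of near-optimal values of \<open>b\<close>, yields the polynomial for \<open>1 \<le> \<nu> \<le> 3\<close>.\<close>

section \<open>The margin of the majority vote and its affine majorants\<close>

text \<open>The backward operator of the biased walk: for \<open>b\<close> in [-1, 1] its
  \<open>k\<close>-th power sends \<open>f\<close> to the function v |-> E f(v + V_k^b), so no
  distribution has to be carried along.\<close>

definition walk_step :: "real \<Rightarrow> (int \<Rightarrow> real) \<Rightarrow> int \<Rightarrow> real" where
  "walk_step b f v = (1 + b) / 2 * f (v + 1) + (1 - b) / 2 * f (v - 1)"

text \<open>\<open>s\<^sub>k(b)\<close> as the expectation of \<open>sgn V\<^sub>k\<^sup>b\<close>.\<close>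

definition majority :: "real \<Rightarrow> nat \<Rightarrow> real" where
  "majority b k = (walk_step b ^^ k) (\<lambda>v. of_int (sgn v)) 0"

text \<open>With \<open>j\<close> up-steps out of \<open>k\<close> the walk started at
  \<open>v\<close> ends at \<open>v + 2 * int j - int k\<close>; Pascal's rule drives the
  induction.\<close>

lemma walk_step_funpow:
  fixes b :: real
  defines "p \<equiv> (1 + b) / 2" and "q \<equiv> (1 - b) / 2"
  shows "(walk_step b ^^ k) f v =
    (\<Sum>j\<le>k. of_nat (k choose j) * p ^ j * q ^ (k - j) * f (v + 2 * int j - int k))"
proof (induction k arbitrary: v)
  case (Suc k)
  define w where "w j = v + 2 * int j - int (Suc k)" for j
  have wS: "w (Suc j) = v + 1 + 2 * int j - int k" "w j = v - 1 + 2 * int j - int k" for j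
    by (simp_all add: w_def)
  have "(\<Sum>j\<le>Suc k. of_nat (Suc k choose j) * p ^ j * q ^ (Suc k - j) * f (w j))
      = q ^ Suc k * f (w 0)
        + (\<Sum>j\<le>k. of_nat (Suc k choose Suc j) * p ^ Suc j * q ^ (k - j) * f (w (Suc j)))"
    by (subst sum.atMost_Suc_shift) simp
  also have "(\<Sum>j\<le>k. of_nat (Suc k choose Suc j) * p ^ Suc j * q ^ (k - j) * f (w (Suc j)))
      = p * (\<Sum>j\<le>k. of_nat (k choose j) * p ^ j * q ^ (k - j) * f (w (Suc j)))
        + (\<Sum>j\<le>k. of_nat (k choose Suc j) * p ^ Suc j * q ^ (k - j) * f (w (Suc j)))"
    by (simp add: sum.distrib[symmetric] sum_distrib_left algebra_simps)
  also have "q ^ Suc k * f (w 0) + (p * (\<Sum>j\<le>k. of_nat (k choose j) * p ^ j * q ^ (k - j) * f (w (Suc j)))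
        + (\<Sum>j\<le>k. of_nat (k choose Suc j) * p ^ Suc j * q ^ (k - j) * f (w (Suc j))))
      = p * (\<Sum>j\<le>k. of_nat (k choose j) * p ^ j * q ^ (k - j) * f (w (Suc j)))
        + (\<Sum>j\<le>Suc k. of_nat (k choose j) * p ^ j * q ^ (Suc k - j) * f (w j))"
    unfolding sum.atMost_Suc_shift[of "\<lambda>j. of_nat (k choose j) * p ^ j * q ^ (Suc k - j) * f (w j)"]
    by simp
  \<comment> \<open>The coefficient at \<open>j = Suc k\<close> is zero, so the range shrinks and a
    factor \<open>q\<close> comes out.\<close>
  also have "(\<Sum>j\<le>Suc k. of_nat (k choose j) * p ^ j * q ^ (Suc k - j) * f (w j))
      = q * (\<Sum>j\<le>k. of_nat (k choose j) * p ^ j * q ^ (k - j) * f (w j))"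
    by (simp add: sum_distrib_left Suc_diff_le algebra_simps)
  finally have binomial: "(\<Sum>j\<le>Suc k. of_nat (Suc k choose j) * p ^ j * q ^ (Suc k - j) * f (w j))
      = p * (walk_step b ^^ k) f (v + 1) + q * (walk_step b ^^ k) f (v - 1)"
    by (simp only: Suc.IH wS(1)) (simp only: wS(2))
  have "(walk_step b ^^ Suc k) f v = p * (walk_step b ^^ k) f (v + 1) + q * (walk_step b ^^ k) f (v - 1)"
    by (simp add: walk_step_def p_def q_def)
  then show ?case
    by (simp only: binomial w_def[symmetric])
qed simp

text \<open>A further vote matters only after a tie: the contributions of \<open>V\<^sub>k = 1\<close> and \<open>V\<^sub>k = -1\<close> cancel.\<close>

lemma majority_Suc:
  "majority b (Suc k) = majority b k +
    (if even k then b * (of_nat (k choose (k div 2)) * ((1 - b\<^sup>2) / 4) ^ (k div 2)) else 0)"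
proof -
  define p q where "p = (1 + b) / 2" and "q = (1 - b) / 2"
  \<comment> \<open>The expected change of \<open>sgn\<close> in one more step from
    \<open>v\<close>; it can be nonzero only at -1, 0 and 1.\<close>
  define g :: "int \<Rightarrow> real" where
    "g v = walk_step b (\<lambda>v. of_int (sgn v)) v - of_int (sgn v)" for v
  have pq: "p * q = (1 - b\<^sup>2) / 4"
    by (simp add: p_def q_def power2_eq_square field_simps)
  have g0: "g 0 = b" and g1: "g 1 = - q" and gm1: "g (-1) = p"
    by (simp_all add: g_def walk_step_def p_def q_def field_simps)
  have g: "g v = 0" if "v \<ge> 2 \<or> v \<le> -2" for v
    using that by (auto simp: g_def walk_step_def field_simps)
  let ?c = "\<lambda>j. of_nat (k choose j) * p ^ j * q ^ (k - j) * g (2 * int j - int k)"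
  \<comment> \<open>\<open>funpow_Suc_right\<close> applies the extra step to \<open>sgn\<close>
    first, which makes it the last step of the walk.\<close>
  have diff: "majority b (Suc k) - majority b k = (\<Sum>j\<le>k. ?c j)"
    unfolding majority_def funpow_Suc_right o_def walk_step_funpow p_def[symmetric] q_def[symmetric]
    by (simp add: sum_subtractf[symmetric] g_def algebra_simps)
  show ?thesis
  proof (cases "even k")
    case True
    then obtain i where k: "k = 2 * i" by blast
    have "(\<Sum>j\<le>k. ?c j) = (\<Sum>j\<in>{i}. ?c j)"
      by (rule sum.mono_neutral_right) (auto simp: k intro!: g)
    also have "\<dots> = b * (of_nat (k choose i) * (p * q) ^ i)"
      by (simp add: k g0 power_mult_distrib)
    finally show ?thesis
      using diff k by (simp add: pq)
  next
    case False
    then obtain i where k: "k = Suc (2 * i)" by (auto elim: oddE)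
    have "(\<Sum>j\<le>k. ?c j) = (\<Sum>j\<in>{i, Suc i}. ?c j)"
      by (rule sum.mono_neutral_right) (auto simp: k intro!: g)
    \<comment> \<open>With equal binomial coefficients, \<open>g 1 = - q\<close> and
      \<open>g (-1) = p\<close> turn the two terms into opposite multiples of (pq)^(i+1).\<close>
    also have "(k choose Suc i) = (k choose i)"
      using binomial_symmetric[of i k] by (simp add: k)
    then have "(\<Sum>j\<in>{i, Suc i}. ?c j) = 0"
      by (simp add: k g1 gm1 Suc_diff_le)
    finally show ?thesis
      using diff False by simp
  qed
qed

text \<open>Pascal's rule twice, with the central coefficient maximal in its row. As (1 - b^2)/4 is
  at most 1/4, the factor 4 makes the successive gains of the margin nonincreasing.\<close>

lemma central_binomial_Suc_le: "(2 * Suc i) choose (Suc i) \<le> 4 * ((2 * i) choose i)"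
proof -
  have "(2 * Suc i) choose (Suc i) = 2 * (Suc (2 * i) choose i)"
    using binomial_symmetric[of i "Suc (2 * i)"] by simp
  also have "Suc (2 * i) choose i \<le> 2 * ((2 * i) choose i)"
  proof (cases i)
    case (Suc j)
    have "Suc (2 * i) choose Suc j = (2 * i choose j) + (2 * i choose Suc j)"
      by (rule binomial_Suc_Suc)
    then show ?thesis
      using binomial_maximum'[of i j] Suc by simp
  qed simp
  finally show ?thesis by simp
qed

text \<open>The margin gains \<open>b * u i\<close> from \<open>2 * i\<close> to
  \<open>Suc (2 * i)\<close> and nothing at the next step. Since \<open>u\<close> is nonincreasing
  with \<open>u 0 = 1\<close> and \<open>u 1 = 2 * c\<close>, the margin stays below the lines
  through its values at k = 0, 1 and at k = 1, 3.\<close>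

lemma majority_le:
  assumes "0 \<le> b" "b \<le> 1"
  shows "majority b k \<le> b * real k"
    and "majority b k \<le> b * (1 + (real k - 1) * ((1 - b\<^sup>2) / 4))"
proof -
  define c where "c = (1 - b\<^sup>2) / 4"
  have c: "0 \<le> c" "c \<le> 1 / 4"
    using assms by (auto simp: c_def power_le_one)
  define u where "u i = real ((2 * i) choose i) * c ^ i" for i
  have u_Suc: "u (Suc i) \<le> u i" for i
  proof -
    have "u (Suc i) \<le> real (4 * ((2 * i) choose i)) * c ^ Suc i"
      unfolding u_def using c by (intro mult_right_mono of_nat_mono central_binomial_Suc_le) auto
    also have "\<dots> = u i * (4 * c)" by (simp add: u_def)
    also have "\<dots> \<le> u i * 1"
      using c by (intro mult_left_mono) (auto simp: u_def)
    finally show ?thesis by simp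
  qed
  have u_antimono: "u (i + n) \<le> u n" for i n
  proof (induction i)
    case (Suc i)
    then show ?case using u_Suc[of "i + n"] by simp
  qed simp
  have u1: "u i \<le> 1" for i
    using u_antimono[of i 0] by (simp add: u_def)
  have u2: "u (Suc i) \<le> 2 * c" for i
    using u_antimono[of i 1] by (simp add: u_def)
  have M0: "majority b 0 = 0" by (simp add: majority_def)
  have even: "majority b (Suc (2 * i)) = majority b (2 * i) + b * u i" for i
    by (simp add: majority_Suc u_def c_def)
  have odd: "majority b (Suc (Suc (2 * i))) = majority b (Suc (2 * i))" for i
    by (subst majority_Suc) simp
  have bound: "majority b (Suc (2 * i)) \<le> b * (1 + 2 * real i * c)" for i
  proof (induction i)
    case 0
    then show ?case using even[of 0] by (simp add: M0 u_def)
  next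
    case (Suc i)
    have "b * u (Suc i) \<le> b * (2 * c)"
      using assms by (intro mult_left_mono u2) auto
    then show ?case
      using Suc even[of "Suc i"] odd[of i] by (simp add: algebra_simps)
  qed
  show "majority b k \<le> b * real k"
  proof (induction k)
    case (Suc k)
    have "(if even k then b * u (k div 2) else 0) \<le> b"
      using u1 assms mult_left_mono[of "u (k div 2)" 1 b] by auto
    then have "majority b (Suc k) \<le> majority b k + b"
      by (auto simp: majority_Suc u_def c_def)
    then show ?case using Suc by (simp add: algebra_simps)
  qed (simp add: M0)
  show "majority b k \<le> b * (1 + (real k - 1) * ((1 - b\<^sup>2) / 4))"
  proof (cases "k = 0")
    \<comment> \<open>At \<open>k = 0\<close> the second line has the value
      \<open>b * (1 - c)\<close>, which is nonnegative.\<close>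
    case True
    then show ?thesis using c assms by (simp add: M0 flip: c_def)
  next
    case False
    show ?thesis
    proof (cases "even k")
      case True
      then obtain j where "k = 2 * j" by blast
      with False obtain i where k: "k = Suc (Suc (2 * i))" by (cases j) auto
      \<comment> \<open>An even \<open>k > 0\<close> has the margin of \<open>k - 1\<close>, and the
        line is nondecreasing.\<close>
      have "b * (1 + 2 * real i * c) \<le> b * (1 + (real k - 1) * c)"
        using c assms by (intro mult_left_mono add_left_mono mult_right_mono) (auto simp: k)
      then show ?thesis
        using bound[of i] odd[of i] unfolding c_def[symmetric] by (simp add: k)
    next
      case False
      then obtain i where k: "k = Suc (2 * i)" by (auto elim: oddE)
      show ?thesis using bound[of i] unfolding c_def[symmetric] by (simp add: k)
    qed
  qed
qed

section \<open>Noisy distributions attached to a labelling\<close>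

definition noisy :: "nat \<Rightarrow> real \<Rightarrow> (nat \<Rightarrow> int) \<Rightarrow> (nat \<times> int) pmf" where
  "noisy d b \<sigma> = pmf_of_set {1..d} \<bind> (\<lambda>x. map_pmf (\<lambda>y. (x, \<sigma> x * y)) (Y_pmf b))"

lemma expectation_Y_pmf:
  assumes "-1 \<le> b" "b \<le> 1"
  shows "measure_pmf.expectation (Y_pmf b) f = (1 + b) / 2 * f 1 + (1 - b) / 2 * (f (-1) :: real)"
proof -
  have p: "0 \<le> (1 + b) / 2" "(1 + b) / 2 \<le> 1"
    using assms by auto
  have q: "1 - (1 + b) / 2 = (1 - b) / 2"
    by (simp add: field_simps)
  show ?thesis
    unfolding Y_pmf_def integral_map_pmf integral_bernoulli_pmf[OF p] q by (simp add: mult.commute)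
qed

lemma set_Y_pmf: "set_pmf (Y_pmf b) \<subseteq> labels"
  by (auto simp: Y_pmf_def labels_def)

lemma expectation_noisy:
  fixes f :: "nat \<times> int \<Rightarrow> real"
  assumes "-1 \<le> b" "b \<le> 1" "d \<ge> 1"
  shows "measure_pmf.expectation (noisy d b \<sigma>) f =
    (\<Sum>x\<in>{1..d}. (1 + b) / 2 * f (x, \<sigma> x) + (1 - b) / 2 * f (x, - \<sigma> x)) / real d"
proof -
  have fin: "finite (set_pmf (Y_pmf b))"
    using set_Y_pmf by (rule finite_subset) (simp add: labels_def)
  define g where "g x = (1 + b) / 2 * f (x, \<sigma> x) + (1 - b) / 2 * f (x, - \<sigma> x)" for x
  have "measure_pmf.expectation (map_pmf (\<lambda>y. (x, \<sigma> x * y)) (Y_pmf b)) f = g x" for x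
    unfolding integral_map_pmf expectation_Y_pmf[OF assms(1,2)] g_def by simp
  moreover have "measure_pmf.expectation (noisy d b \<sigma>) f =
      (\<Sum>x\<in>{1..d}. measure_pmf.expectation (map_pmf (\<lambda>y. (x, \<sigma> x * y)) (Y_pmf b)) f /\<^sub>R
        real (card {1..d}))"
    unfolding noisy_def using assms(3) fin by (intro pmf_expectation_bind_pmf_of_set) auto
  ultimately show ?thesis
    unfolding g_def[symmetric] by (simp add: sum_distrib_left divide_inverse_commute)
qed

lemma set_pmf_noisy:
  assumes "d \<ge> 1" "\<sigma> \<in> hyps d"
  shows "set_pmf (noisy d b \<sigma>) \<subseteq> {1..d} \<times> labels"
proof -
  have "(x, \<sigma> x * y) \<in> {1..d} \<times> labels" if "x \<in> {1..d}" "y \<in> set_pmf (Y_pmf b)" for x y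
  proof -
    have "y \<in> labels" "\<sigma> x \<in> labels"
      using assms(2) that set_Y_pmf[of b] by (auto simp: hyps_def)
    then show ?thesis
      using that by (auto simp: labels_def)
  qed
  moreover have "set_pmf (noisy d b \<sigma>) = (\<Union>x\<in>{1..d}. (\<lambda>y. (x, \<sigma> x * y)) ` set_pmf (Y_pmf b))"
    using assms(1) by (simp add: noisy_def)
  ultimately show ?thesis
    by (simp only: UN_subset_iff image_subset_iff) blast
qed

text \<open>The product \<open>\<sigma> x * y\<close> is 1 or -1 according to whether the label
  agrees with \<open>\<sigma>\<close>, so one formula covers both label probabilities.\<close>

lemma pmf_noisy:
  assumes "-1 \<le> b" "b \<le> 1" "d \<ge> 1" "\<sigma> \<in> hyps d" "x \<in> {1..d}" "y \<in> labels"
  shows "pmf (noisy d b \<sigma>) (x, y) = (1 + b * of_int (\<sigma> x * y)) / (2 * real d)"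
proof -
  have sx: "\<sigma> x = 1 \<or> \<sigma> x = -1"
    using assms by (auto simp: hyps_def labels_def)
  have "pmf (noisy d b \<sigma>) (x, y)
      = measure_pmf.expectation (noisy d b \<sigma>) (indicator {(x, y)})"
    by (simp add: pmf.rep_eq)
  also have "\<dots> = (\<Sum>x'\<in>{1..d}. if x' = x then (1 + b * of_int (\<sigma> x * y)) / 2 else 0) / real d"
    unfolding expectation_noisy[OF assms(1-3)] using assms(6) sx
    by (intro arg_cong[where f = "\<lambda>s. s / real d"] sum.cong) (auto simp: indicator_def labels_def)
  finally show ?thesis using assms by simp
qed

section \<open>Independent samples and sign flips\<close>

lemma finite_samples: "finite (samples m d)"
  using finite_lists_length_eq[of "{1..d} \<times> labels" m]
  by (simp add: samples_def labels_def conj_commute)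

lemma distrs_finite: "D \<in> distrs d \<Longrightarrow> finite (set_pmf D)"
  by (rule finite_subset[of _ "{1..d} \<times> labels"]) (auto simp: distrs_def labels_def)

lemma set_replicate_pmf_samples: "D \<in> distrs d \<Longrightarrow> set_pmf (replicate_pmf m D) \<subseteq> samples m d"
  by (auto simp: set_replicate_pmf distrs_def samples_def lists_eq_set)

lemma expectation_replicate_pmf:
  fixes f :: "(nat \<times> int) list \<Rightarrow> real"
  assumes "D \<in> distrs d"
  shows "measure_pmf.expectation (replicate_pmf m D) f =
    (\<Sum>z\<in>samples m d. f z * pmf (replicate_pmf m D) z)"
  using set_replicate_pmf_samples[OF assms] by (intro integral_measure_pmf_real finite_samples) auto

lemma replicate_pmf_Suc_map:
  "replicate_pmf (Suc n) D = D \<bind> (\<lambda>a. map_pmf ((#) a) (replicate_pmf n D))"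
  by (simp add: map_pmf_def)

lemma finite_set_replicate_pmf: "finite (set_pmf D) \<Longrightarrow> finite (set_pmf (replicate_pmf n D))"
  by (induction n) (simp, simp only: replicate_pmf_Suc_map set_bind_pmf set_map_pmf, blast)

lemma expectation_replicate_pmf_Suc:
  fixes f :: "'a list \<Rightarrow> real"
  assumes "finite (set_pmf D)"
  shows "measure_pmf.expectation (replicate_pmf (Suc n) D) f =
    measure_pmf.expectation D (\<lambda>a. measure_pmf.expectation (replicate_pmf n D) (\<lambda>z. f (a # z)))"
proof -
  have "measure_pmf.expectation (replicate_pmf (Suc n) D) f
    = (\<Sum>a\<in>set_pmf D. pmf D a *\<^sub>R measure_pmf.expectation (map_pmf ((#) a) (replicate_pmf n D)) f)"
    unfolding replicate_pmf_Suc_map using assms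
    by (intro pmf_expectation_bind) (auto intro: finite_set_replicate_pmf)
  also have "\<dots> = measure_pmf.expectation D (\<lambda>a. measure_pmf.expectation (replicate_pmf n D) (\<lambda>z. f (a # z)))"
    by (subst integral_measure_pmf[of "set_pmf D"]) (auto simp: assms)
  finally show ?thesis .
qed

lemma pmf_replicate_pmf_Cons:
  "pmf (replicate_pmf (Suc n) D) (a # z) = pmf D a * pmf (replicate_pmf n D) z"
proof -
  have "replicate_pmf (Suc n) D = map_pmf (\<lambda>(x, xs). x # xs) (pair_pmf D (replicate_pmf n D))"
    by (simp add: pair_pmf_def map_bind_pmf)
  moreover have "inj (\<lambda>(x, xs). x # xs :: 'a list)"
    by (auto intro: injI)
  ultimately show ?thesis
    using pmf_map_inj'[of "\<lambda>(x, xs). x # xs" "pair_pmf D (replicate_pmf n D)" "(a, z)"]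
    by (simp add: pmf_pair)
qed

lemma noisy_distrs: "d \<ge> 1 \<Longrightarrow> \<sigma> \<in> hyps d \<Longrightarrow> noisy d b \<sigma> \<in> distrs d"
  using set_pmf_noisy by (simp add: distrs_def)

lemma flip_hyps: "\<sigma> \<in> hyps d \<Longrightarrow> x \<in> {1..d} \<Longrightarrow> \<sigma>(x := - \<sigma> x) \<in> hyps d"
  by (auto simp: hyps_def labels_def PiE_iff extensional_def)

lemma hyps_cases: "\<sigma> \<in> hyps d \<Longrightarrow> x \<in> {1..d} \<Longrightarrow> \<sigma> x = 1 \<or> \<sigma> x = -1"
  by (auto simp: hyps_def labels_def)

lemma finite_hyps: "finite (hyps d)"
  by (auto simp: hyps_def labels_def intro!: finite_PiE)

lemma hyps_nonempty: "hyps d \<noteq> {}"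
  by (simp add: hyps_def labels_def PiE_eq_empty_iff)

section \<open>Testing a labelling against its flip at one point\<close>

text \<open>The factor \<open>\<sigma> x\<close> makes a positive vote one in favour of
  \<open>\<sigma>\<close>. Under \<open>noisy d b \<sigma>\<close>, given N observations of
  \<open>x\<close>, the vote is distributed as V_N^b.\<close>

definition vote :: "(nat \<Rightarrow> int) \<Rightarrow> nat \<Rightarrow> (nat \<times> int) list \<Rightarrow> int" where
  "vote \<sigma> x z = (\<Sum>(a, y)\<leftarrow>z. if a = x then \<sigma> x * y else 0)"

lemma vote_simps [simp]:
  "vote \<sigma> x [] = 0"
  "vote \<sigma> x ((a, y) # z) = (if a = x then \<sigma> x * y else 0) + vote \<sigma> x z"
  by (simp_all add: vote_def)

text \<open>The parameter \<open>j\<close> counts draws at \<open>x\<close> already turned into walk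
  steps. A further draw hits \<open>x\<close> with probability 1/d and then raises \<open>j\<close>
  by one; otherwise it changes nothing. This replaces conditioning on the binomial number of
  observations of \<open>x\<close>.\<close>

lemma expectation_vote_le:
  assumes b: "-1 \<le> b" "b \<le> 1" and d: "d \<ge> 1" and \<sigma>: "\<sigma> \<in> hyps d" and x: "x \<in> {1..d}"
    and majority: "\<And>k. majority b k \<le> \<alpha> + \<beta> * real k"
  shows "measure_pmf.expectation (replicate_pmf m (noisy d b \<sigma>))
      (\<lambda>z. (walk_step b ^^ j) (\<lambda>v. of_int (sgn v)) (vote \<sigma> x z))
    \<le> \<alpha> + \<beta> * (real j + real m / real d)"
proof (induction m arbitrary: j)
  case 0
  then show ?case using majority[of j] by (simp add: majority_def)
next
  case (Suc m)
  define F where "F j = (walk_step b ^^ j) (\<lambda>v. of_int (sgn v))" for j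
  define R where "R = replicate_pmf m (noisy d b \<sigma>)"
  define E where "E f = measure_pmf.expectation R (\<lambda>z. f (vote \<sigma> x z))" for f :: "int \<Rightarrow> real"
  have fin: "finite (set_pmf (noisy d b \<sigma>))"
    using noisy_distrs[OF d \<sigma>] by (rule distrs_finite)
  then have int: "integrable (measure_pmf R) f" for f :: "(nat \<times> int) list \<Rightarrow> real"
    unfolding R_def by (intro integrable_measure_pmf_finite finite_set_replicate_pmf)
  have IH: "E (F i) \<le> \<alpha> + \<beta> * (real i + real m / real d)" for i
    using Suc.IH[of i] by (simp only: E_def R_def F_def)
  have sx: "\<sigma> x * \<sigma> x = 1"
    using hyps_cases[OF \<sigma> x] by auto
  \<comment> \<open>Averaging over the label of a draw at \<open>x\<close> is one application of
    \<open>walk_step\<close>.\<close>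
  have step: "(1 + b) / 2 * E (\<lambda>v. F j (1 + v)) + (1 - b) / 2 * E (\<lambda>v. F j (-1 + v)) = E (F (Suc j))"
    unfolding E_def by (simp add: F_def walk_step_def int add.commute)
  have Cons:
    "measure_pmf.expectation R (\<lambda>z. F j (vote \<sigma> x ((x', \<sigma> x') # z)))
      = (if x' = x then E (\<lambda>v. F j (1 + v)) else E (F j))"
    "measure_pmf.expectation R (\<lambda>z. F j (vote \<sigma> x ((x', - \<sigma> x') # z)))
      = (if x' = x then E (\<lambda>v. F j (-1 + v)) else E (F j))" for x'
    by (simp_all add: sx E_def)
  have "measure_pmf.expectation (replicate_pmf (Suc m) (noisy d b \<sigma>)) (\<lambda>z. F j (vote \<sigma> x z))
    = (\<Sum>x'\<in>{1..d}. if x' = x then E (F (Suc j)) else E (F j)) / real d"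
    unfolding expectation_replicate_pmf_Suc[OF fin] expectation_noisy[OF b d] R_def[symmetric] Cons
      step[symmetric]
    by (intro arg_cong[where f = "\<lambda>s. s / real d"] sum.cong refl) (simp add: field_simps)
  also have "(\<Sum>x'\<in>{1..d}. if x' = x then E (F (Suc j)) else E (F j))
      = E (F (Suc j)) + (real d - 1) * E (F j)"
    using x d by (subst sum.remove[of _ x]) (auto simp: of_nat_diff)
  also have "\<dots> / real d \<le> ((\<alpha> + \<beta> * (real (Suc j) + real m / real d))
      + (real d - 1) * (\<alpha> + \<beta> * (real j + real m / real d))) / real d"
    using d by (intro divide_right_mono add_mono mult_left_mono IH) auto
  also have "\<dots> = \<alpha> + \<beta> * (real j + real (Suc m) / real d)"
    using d by (simp add: field_simps)
  finally show ?case by (simp only: F_def)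
qed

text \<open>The exponent is the log-likelihood ratio of the two labellings in units of \<open>ln r\<close>.\<close>

lemma pmf_replicate_noisy_flip:
  fixes b :: real and \<sigma> :: "nat \<Rightarrow> int" and x :: nat
  defines "r \<equiv> (1 + b) / (1 - b)" and "\<tau> \<equiv> \<sigma>(x := - \<sigma> x)"
  assumes b: "-1 < b" "b < 1" and d: "d \<ge> 1" and \<sigma>: "\<sigma> \<in> hyps d" and x: "x \<in> {1..d}"
    and z: "set z \<subseteq> {1..d} \<times> labels"
  shows "pmf (replicate_pmf (length z) (noisy d b \<sigma>)) z =
    pmf (replicate_pmf (length z) (noisy d b \<tau>)) z * r powi vote \<sigma> x z"
proof -
  have \<tau>: "\<tau> \<in> hyps d" unfolding \<tau>_def by (rule flip_hyps[OF \<sigma> x])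
  from z show ?thesis
  proof (induction z)
    case (Cons ay z)
    obtain a y where ay: "ay = (a, y)" by force
    have a: "a \<in> {1..d}" "y \<in> labels" using Cons.prems ay by auto
    have r: "r \<noteq> 0" using b by (simp add: r_def)
    have "\<sigma> a = 1 \<or> \<sigma> a = -1" "y = 1 \<or> y = -1"
      using a \<sigma> by (auto simp: hyps_def labels_def)
    then have "1 + b * of_int (\<sigma> a * y) = (1 + b * of_int (\<tau> a * y))
        * r powi (if a = x then \<sigma> x * y else 0)"
      using b by (auto simp: r_def \<tau>_def power_int_minus)
    then have "pmf (noisy d b \<sigma>) (a, y) = pmf (noisy d b \<tau>) (a, y)
        * r powi (if a = x then \<sigma> x * y else 0)"
      using b by (subst (1 2) pmf_noisy) (auto simp only: d \<sigma> a \<tau> times_divide_eq_left)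
    then show ?case
      using Cons r by (simp add: ay pmf_replicate_pmf_Cons power_int_add del: replicate_pmf.simps)
  qed simp
qed

text \<open>Le Cam's two-point argument: the errors add up to at least the sum of min(P, Q). The
  sign of the vote tells which likelihood is larger, so this sum is expressed by the expectations of
  \<open>S\<close> under P and Q, which the majorant controls.\<close>

lemma two_point_error_ge:
  fixes b :: real and \<sigma> :: "nat \<Rightarrow> int" and x :: nat
  assumes b: "0 \<le> b" "b < 1" and d: "d \<ge> 1" and \<sigma>: "\<sigma> \<in> hyps d" and x: "x \<in> {1..d}"
    and L: "L \<in> learners m d"
    and majority: "\<And>k. majority b k \<le> \<alpha> + \<beta> * real k"
  defines "\<tau> \<equiv> \<sigma>(x := - \<sigma> x)"
  shows "1 - (\<alpha> + \<beta> * (real m / real d)) \<le>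
    measure_pmf.expectation (replicate_pmf m (noisy d b \<sigma>)) (\<lambda>z. of_bool (L z x \<noteq> \<sigma> x)) +
    measure_pmf.expectation (replicate_pmf m (noisy d b \<tau>)) (\<lambda>z. of_bool (L z x \<noteq> \<tau> x))"
proof -
  define P where "P = pmf (replicate_pmf m (noisy d b \<sigma>))"
  define Q where "Q = pmf (replicate_pmf m (noisy d b \<tau>))"
  define S where "S z = real_of_int (sgn (vote \<sigma> x z))" for z
  have \<tau>: "\<tau> \<in> hyps d" and \<tau>x: "\<tau> x = - \<sigma> x"
    using flip_hyps[OF \<sigma> x] by (simp_all add: \<tau>_def)
  have vote_\<tau>: "vote \<tau> x z = - vote \<sigma> x z" for z
    by (induction z) (auto simp: \<tau>x)
  note E = expectation_replicate_pmf[OF noisy_distrs[OF d \<sigma>, of b], where m = m]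
    expectation_replicate_pmf[OF noisy_distrs[OF d \<tau>, of b], where m = m]
  have sum1: "(\<Sum>z\<in>samples m d. P z) = 1" "(\<Sum>z\<in>samples m d. Q z) = 1"
    using E(1)[of "\<lambda>_. 1"] E(2)[of "\<lambda>_. 1"] by (simp_all add: P_def Q_def)
  have "(\<Sum>z\<in>samples m d. S z * P z) \<le> \<alpha> + \<beta> * (real m / real d)"
    using expectation_vote_le[OF _ _ d \<sigma> x majority, where m = m and j = 0] b
    by (simp add: E S_def P_def)
  \<comment> \<open>Flipping the labelling at \<open>x\<close> negates the vote, so the same bound
    applied to \<open>\<tau>\<close> controls \<open>- S\<close>.\<close>
  moreover have "- (\<Sum>z\<in>samples m d. S z * Q z) \<le> \<alpha> + \<beta> * (real m / real d)"
    using expectation_vote_le[OF _ _ d \<tau> x majority, where m = m and j = 0] b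
    by (simp add: E S_def Q_def vote_\<tau> sum_negf)
  moreover have "(\<Sum>z\<in>samples m d. (P z + Q z - (S z * P z - S z * Q z)) / 2)
      = (2 - ((\<Sum>z\<in>samples m d. S z * P z) - (\<Sum>z\<in>samples m d. S z * Q z))) / 2"
    unfolding sum_divide_distrib[symmetric] sum_subtractf sum.distrib sum1 by simp
  ultimately have "1 - (\<alpha> + \<beta> * (real m / real d))
      \<le> (\<Sum>z\<in>samples m d. (P z + Q z - (S z * P z - S z * Q z)) / 2)"
    by (simp add: field_simps)
  also have "\<dots> \<le> (\<Sum>z\<in>samples m d. of_bool (L z x \<noteq> \<sigma> x) * P z + of_bool (L z x \<noteq> \<tau> x) * Q z)"
  proof (rule sum_mono)
    fix z assume z: "z \<in> samples m d"
    define r where "r = (1 + b) / (1 - b)"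
    have r: "1 \<le> r" using b by (simp add: r_def)
    have PQ: "P z = Q z * r powi vote \<sigma> x z"
      using pmf_replicate_noisy_flip[OF _ _ d \<sigma> x, of b z] b z
      by (simp add: P_def Q_def \<tau>_def r_def samples_def)
    have nonneg: "0 \<le> P z" "0 \<le> Q z" by (simp_all add: P_def Q_def)
    have Lz: "L z x = 1 \<or> L z x = -1"
      using L z x by (intro hyps_cases[of _ d]) (auto simp: learners_def)
    \<comment> \<open>The left side is (P + Q - |P - Q|) / 2: by \<open>PQ\<close> and
      \<open>1 \<le> r\<close>, P - Q never has the sign opposite to the vote, and it vanishes at a
      tie.\<close>
    have "(P z + Q z - (S z * P z - S z * Q z)) / 2 \<le> min (P z) (Q z)"
    proof (cases "vote \<sigma> x z" "0 :: int" rule: linorder_cases)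
      case less
      then have "1 \<le> r powi (- vote \<sigma> x z)"
        using r by (intro one_le_power_int) auto
      then have "r powi vote \<sigma> x z \<le> 1"
        using r by (simp add: power_int_minus one_le_inverse_iff)
      then have "P z \<le> Q z"
        using nonneg mult_left_mono[of "r powi vote \<sigma> x z" 1 "Q z"] by (simp add: PQ)
      then show ?thesis using less by (simp add: S_def)
    next
      case equal
      then show ?thesis using PQ by (simp add: S_def)
    next
      case greater
      then have "1 \<le> r powi vote \<sigma> x z"
        using r by (intro one_le_power_int) auto
      then have "Q z \<le> P z"
        using nonneg mult_left_mono[of 1 "r powi vote \<sigma> x z" "Q z"] by (simp add: PQ)
      then show ?thesis using greater by (simp add: S_def)
    qed
    \<comment> \<open>The prediction \<open>L z x\<close> is a sign, hence wrong for exactly one of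
      \<open>\<sigma>\<close> and \<open>\<tau>\<close>.\<close>
    also have "\<dots> \<le> of_bool (L z x \<noteq> \<sigma> x) * P z + of_bool (L z x \<noteq> \<tau> x) * Q z"
      using nonneg Lz hyps_cases[OF \<sigma> x] by (auto simp: \<tau>x)
    finally show "(P z + Q z - (S z * P z - S z * Q z)) / 2
        \<le> of_bool (L z x \<noteq> \<sigma> x) * P z + of_bool (L z x \<noteq> \<tau> x) * Q z" .
  qed
  finally show ?thesis
    by (simp add: E P_def Q_def sum.distrib)
qed

section \<open>The risk summed over all labellings\<close>

lemma err_noisy:
  assumes b: "-1 \<le> b" "b \<le> 1" and d: "d \<ge> 1" and \<sigma>: "\<sigma> \<in> hyps d" and h: "h \<in> hyps d"
  shows "err h (noisy d b \<sigma>) = (1 - b) / 2 + b / real d * (\<Sum>x\<in>{1..d}. of_bool (h x \<noteq> \<sigma> x))"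
proof -
  have "err h (noisy d b \<sigma>)
      = measure_pmf.expectation (noisy d b \<sigma>) (indicator {(x, y). h x \<noteq> y})"
    by (simp add: err_def)
  also have "\<dots> = (\<Sum>x\<in>{1..d}. (1 - b) / 2 + b * of_bool (h x \<noteq> \<sigma> x)) / real d"
    unfolding expectation_noisy[OF b d]
  proof (intro arg_cong[where f = "\<lambda>s. s / real d"] sum.cong refl)
    fix x assume "x \<in> {1..d}"
    then show "(1 + b) / 2 * indicator {(x, y). h x \<noteq> y} (x, \<sigma> x)
        + (1 - b) / 2 * indicator {(x, y). h x \<noteq> y} (x, - \<sigma> x)
        = (1 - b) / 2 + b * of_bool (h x \<noteq> \<sigma> x)"
      using hyps_cases[OF \<sigma>, of x] hyps_cases[OF h, of x] by (auto simp: field_simps)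
  qed
  also have "\<dots> = (real d * ((1 - b) / 2) + b * (\<Sum>x\<in>{1..d}. of_bool (h x \<noteq> \<sigma> x))) / real d"
    by (simp add: sum.distrib sum_distrib_left)
  finally show ?thesis
    using d by (simp add: add_divide_distrib)
qed

text \<open>The labelling \<open>\<sigma>\<close> itself attains the minimal error (1 - b)/2, and
  each point of disagreement with it costs b/d.\<close>

lemma excess_noisy:
  assumes b: "0 \<le> b" "b \<le> 1" and d: "d \<ge> 1" and \<sigma>: "\<sigma> \<in> hyps d" and h: "h \<in> hyps d"
  shows "excess d h (noisy d b \<sigma>) = b / real d * (\<Sum>x\<in>{1..d}. of_bool (h x \<noteq> \<sigma> x))"
proof -
  note err = err_noisy[OF _ b(2) d \<sigma>]
  have "(MIN g\<in>hyps d. err g (noisy d b \<sigma>)) = (1 - b) / 2"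
  proof (rule Min_eqI)
    show "finite ((\<lambda>g. err g (noisy d b \<sigma>)) ` hyps d)"
      by (simp add: finite_hyps)
    show "(1 - b) / 2 \<in> (\<lambda>g. err g (noisy d b \<sigma>)) ` hyps d"
      using err[OF _ \<sigma>] b by (intro image_eqI[OF _ \<sigma>]) simp
    show "(1 - b) / 2 \<le> e" if e: "e \<in> (\<lambda>g. err g (noisy d b \<sigma>)) ` hyps d" for e
    proof -
      obtain g where g: "g \<in> hyps d" "e = err g (noisy d b \<sigma>)" using e by blast
      have "0 \<le> b / real d * (\<Sum>x\<in>{1..d}. of_bool (g x \<noteq> \<sigma> x))"
        using b by (intro mult_nonneg_nonneg sum_nonneg) auto
      then show ?thesis using err[OF _ g(1)] g(2) b by linarith
    qed
  qed
  then show ?thesis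
    using err[OF _ h] b by (simp add: excess_def)
qed

text \<open>The risk splits into errors at single points. At a fixed \<open>x\<close> the flip
  permutes the labellings, so the two-point bound holds on average, with half its value per
  labelling.\<close>

lemma sum_risk_ge:
  assumes b: "0 \<le> b" "b < 1" and d: "d \<ge> 1" and L: "L \<in> learners m d"
    and majority: "\<And>k. majority b k \<le> \<alpha> + \<beta> * real k"
  shows "real (card (hyps d)) * (b * ((1 - (\<alpha> + \<beta> * (real m / real d))) / 2))
    \<le> (\<Sum>\<sigma>\<in>hyps d. risk m d L (noisy d b \<sigma>))"
proof -
  define e where "e \<sigma> x =
    measure_pmf.expectation (replicate_pmf m (noisy d b \<sigma>)) (\<lambda>z. of_bool (L z x \<noteq> \<sigma> x) :: real)"
    for \<sigma> x
  define C where "C = 1 - (\<alpha> + \<beta> * (real m / real d))"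
  have risk: "risk m d L (noisy d b \<sigma>) = b / real d * (\<Sum>x\<in>{1..d}. e \<sigma> x)" if \<sigma>: "\<sigma> \<in> hyps d" for \<sigma>
  proof -
    note E = expectation_replicate_pmf[OF noisy_distrs[OF d \<sigma>]]
    have "risk m d L (noisy d b \<sigma>) = (\<Sum>z\<in>samples m d. \<Sum>x\<in>{1..d}.
        b / real d * (of_bool (L z x \<noteq> \<sigma> x) * pmf (replicate_pmf m (noisy d b \<sigma>)) z))"
      unfolding risk_def E
    proof (rule sum.cong[OF refl])
      fix z assume "z \<in> samples m d"
      then have "L z \<in> hyps d" using L by (auto simp: learners_def)
      then show "excess d (L z) (noisy d b \<sigma>) * pmf (replicate_pmf m (noisy d b \<sigma>)) z = (\<Sum>x\<in>{1..d}.
          b / real d * (of_bool (L z x \<noteq> \<sigma> x) * pmf (replicate_pmf m (noisy d b \<sigma>)) z))"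
        by (simp only: excess_noisy[OF b(1) less_imp_le[OF b(2)] d \<sigma>] sum_distrib_left
            sum_distrib_right mult.assoc)
    qed
    also have "\<dots> = b / real d * (\<Sum>x\<in>{1..d}. e \<sigma> x)"
      unfolding e_def E by (subst sum.swap) (simp only: sum_distrib_left)
    finally show ?thesis .
  qed
  have pair: "real (card (hyps d)) * (C / 2) \<le> (\<Sum>\<sigma>\<in>hyps d. e \<sigma> x)" if x: "x \<in> {1..d}" for x
  proof -
    have "bij_betw (\<lambda>\<sigma>. \<sigma>(x := - \<sigma> x)) (hyps d) (hyps d)"
      by (rule bij_betwI[where g = "\<lambda>\<sigma>. \<sigma>(x := - \<sigma> x)"]) (auto intro: flip_hyps[OF _ x])
    then have flip: "(\<Sum>\<sigma>\<in>hyps d. e (\<sigma>(x := - \<sigma> x)) x) = (\<Sum>\<sigma>\<in>hyps d. e \<sigma> x)"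
      by (rule sum.reindex_bij_betw)
    have "real (card (hyps d)) * C \<le> (\<Sum>\<sigma>\<in>hyps d. e \<sigma> x + e (\<sigma>(x := - \<sigma> x)) x)"
      unfolding e_def C_def
      by (intro sum_bounded_below two_point_error_ge[OF b d _ x L majority])
    then show ?thesis
      by (simp add: sum.distrib flip)
  qed
  have "real (card (hyps d)) * (b * (C / 2))
      = b / real d * (\<Sum>x\<in>{1..d}. real (card (hyps d)) * (C / 2))"
    using d by simp
  also have "\<dots> \<le> b / real d * (\<Sum>x\<in>{1..d}. \<Sum>\<sigma>\<in>hyps d. e \<sigma> x)"
    using b by (intro mult_left_mono sum_mono pair) auto
  also have "\<dots> = (\<Sum>\<sigma>\<in>hyps d. risk m d L (noisy d b \<sigma>))"
    by (subst sum.swap) (simp add: risk sum_distrib_left)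
  finally show ?thesis by (simp only: C_def)
qed

section \<open>Boundedness of the risks and randomized learners\<close>

lemma excess_bounds:
  assumes "h \<in> hyps d"
  shows "0 \<le> excess d h D" "excess d h D \<le> 1"
proof -
  let ?E = "(\<lambda>g. err g D) ` hyps d"
  have "Min ?E \<in> ?E"
    using finite_hyps hyps_nonempty by (intro Min_in) auto
  then have "0 \<le> Min ?E" by (auto simp: err_def)
  moreover have "Min ?E \<le> err h D"
    using assms finite_hyps by (intro Min_le) auto
  moreover have "err h D \<le> 1" by (simp add: err_def)
  ultimately show "0 \<le> excess d h D" "excess d h D \<le> 1"
    by (auto simp: excess_def)
qed

text \<open>Makes the supremum over distributions bounded, as conditional completeness of
  \<open>real\<close> demands.\<close>

lemma risk_le_1:
  assumes "L \<in> learners m d" "D \<in> distrs d"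
  shows "risk m d L D \<le> 1"
proof -
  have "AE z in replicate_pmf m D. L z \<in> hyps d"
    using set_replicate_pmf_samples[OF assms(2)] assms(1)
    by (auto simp: AE_measure_pmf_iff learners_def)
  then show ?thesis
    unfolding risk_def using finite_set_replicate_pmf[OF distrs_finite[OF assms(2)]]
    by (intro measure_pmf.integral_le_const integrable_measure_pmf_finite)
      (auto elim: eventually_mono intro: excess_bounds)
qed

lemma prob_space_unif: "prob_space unif"
  unfolding unif_def by (rule prob_space_uniform_measure) (auto simp: emeasure_restrict_space)

lemma space_unif: "space unif = {-1..1}"
  by (simp add: unif_def space_restrict_space)

lemma rand_learner_section:
  assumes L: "L \<in> rand_learners m d" and u: "u \<in> space unif"
  shows "(\<lambda>z. L z u) \<in> learners m d"
  unfolding learners_def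
proof
  fix z assume "z \<in> samples m d"
  then have "L z \<in> unif \<rightarrow>\<^sub>M count_space (hyps d)"
    using L by (simp add: rand_learners_def)
  from measurable_space[OF this u] show "L z u \<in> hyps d" by simp
qed

text \<open>Fubini: a randomized learner is a mixture over \<open>u\<close> of the deterministic
  learners obtained by fixing \<open>u\<close>.\<close>

lemma rand_risk_eq_integral:
  assumes L: "L \<in> rand_learners m d" and D: "D \<in> distrs d"
  shows "rand_risk m d L D = (LINT u|unif. risk m d (\<lambda>z. L z u) D)"
    and "integrable unif (\<lambda>u. risk m d (\<lambda>z. L z u) D)"
proof -
  define M where "M = restrict_space (measure_pmf (replicate_pmf m D)) (samples m d)"
  have sub: "set_pmf (replicate_pmf m D) \<subseteq> samples m d"
    by (rule set_replicate_pmf_samples[OF D])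
  interpret U: prob_space unif by (rule prob_space_unif)
  interpret M: prob_space M
    unfolding M_def
  proof (rule prob_space_restrict_space)
    show "emeasure (measure_pmf (replicate_pmf m D)) (samples m d) = 1"
      using sub by (simp add: measure_pmf.emeasure_eq_1_AE AE_measure_pmf_iff subset_iff)
  qed simp
  interpret pair_prob_space M unif ..
  have space_M: "space M = samples m d"
    by (simp add: M_def space_restrict_space)
  have sets_M: "sets M = sets (count_space (samples m d))"
    by (auto simp: M_def sets_restrict_space)
  have hyp: "L z u \<in> hyps d" if "z \<in> samples m d" "u \<in> space unif" for z u
    using rand_learner_section[OF L that(2)] that(1) by (auto simp: learners_def)
  \<comment> \<open>The sample space is finite and discrete, so measurability in \<open>u\<close>
    for each \<open>z\<close> gives joint measurability.\<close>
  have meas: "(\<lambda>(z, u). excess d (L z u) D) \<in> borel_measurable (M \<Otimes>\<^sub>M unif)"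
    unfolding measurable_cong_sets[OF sets_pair_measure_cong[OF sets_M refl] refl]
  proof (rule measurable_pair_measure_countable1)
    show "countable (samples m d)"
      by (simp add: finite_samples countable_finite)
    fix z assume "z \<in> samples m d"
    then have "L z \<in> unif \<rightarrow>\<^sub>M count_space (hyps d)"
      using L by (auto simp: rand_learners_def)
    then show "(\<lambda>u. (\<lambda>(z, u). excess d (L z u) D) (z, u)) \<in> borel_measurable unif"
      by (simp add: measurable_compose[where g = "\<lambda>h. excess d h D" and N = "count_space (hyps d)"])
  qed
  have int: "integrable (M \<Otimes>\<^sub>M unif) (\<lambda>(z, u). excess d (L z u) D)"
  proof (rule P.integrable_const_bound[where B = 1])
    show "AE zu in M \<Otimes>\<^sub>M unif. norm (case zu of (z, u) \<Rightarrow> excess d (L z u) D) \<le> 1"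
      by (rule AE_I2) (auto simp: space_pair_measure space_M abs_le_iff
        intro!: excess_bounds hyp order_trans[OF _ excess_bounds(1)])
  qed (rule meas)
  \<comment> \<open>Restricting to \<open>samples m d\<close> discards only a null set.\<close>
  have inner: "(LINT z|M. excess d (L z u) D) = risk m d (\<lambda>z. L z u) D" for u
    unfolding M_def risk_def using sub
    by (subst integral_restrict_space)
      (auto intro!: integral_cong_AE simp: AE_measure_pmf_iff indicator_def)
  show "rand_risk m d L D = (LINT u|unif. risk m d (\<lambda>z. L z u) D)"
    using integral_snd[OF int] by (simp add: inner rand_risk_def M_def[symmetric])
  show "integrable unif (\<lambda>u. risk m d (\<lambda>z. L z u) D)"
    using integrable_snd[OF int] by (simp add: inner)
qed

lemma rand_risk_le_1:
  assumes "L \<in> rand_learners m d" "D \<in> distrs d"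
  shows "rand_risk m d L D \<le> 1"
proof -
  interpret U: prob_space unif by (rule prob_space_unif)
  show ?thesis
    unfolding rand_risk_eq_integral(1)[OF assms]
    by (intro U.integral_le_const rand_risk_eq_integral(2)[OF assms] AE_I2 risk_le_1 assms
      rand_learner_section)
qed

section \<open>From the average over labellings to the minimax risk\<close>

lemma le_SUP_of_sum:
  fixes R :: "'a \<Rightarrow> real"
  assumes "finite A" "A \<noteq> {}" "f ` A \<subseteq> B" "\<And>D. D \<in> B \<Longrightarrow> R D \<le> C"
    and "real (card A) * c \<le> (\<Sum>a\<in>A. R (f a))"
  shows "c \<le> (SUP D\<in>B. R D)"
proof -
  have "(\<Sum>a\<in>A. R (f a)) \<le> real (card A) * (SUP D\<in>B. R D)"
    using assms(3,4) by (intro sum_bounded_above cSUP_upper) (auto simp: bdd_above_def)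
  with assms(5) have "real (card A) * c \<le> real (card A) * (SUP D\<in>B. R D)"
    by simp
  moreover have "0 < real (card A)"
    using assms(1,2) by (simp add: card_gt_0_iff)
  ultimately show ?thesis by simp
qed

lemma minimax_ge:
  fixes b \<alpha> \<beta> :: real and m d :: nat
  assumes b: "0 \<le> b" "b < 1" and d: "d \<ge> 1"
    and majority: "\<And>k. majority b k \<le> \<alpha> + \<beta> * real k"
  defines "c \<equiv> b * ((1 - (\<alpha> + \<beta> * (real m / real d))) / 2)"
  shows "c \<le> minimax m d" "c \<le> rand_minimax m d"
proof -
  obtain h where h: "h \<in> hyps d" using hyps_nonempty by blast
  have noisy: "noisy d b ` hyps d \<subseteq> distrs d"
    using noisy_distrs[OF d] by blast
  have sum: "real (card (hyps d)) * c \<le> (\<Sum>\<sigma>\<in>hyps d. risk m d L (noisy d b \<sigma>))"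
    if "L \<in> learners m d" for L
    unfolding c_def by (rule sum_risk_ge[OF b d that majority])
  show "c \<le> minimax m d"
    unfolding minimax_def
  proof (rule cINF_greatest)
    show "learners m d \<noteq> {}" using h by (auto simp: learners_def)
  qed (auto intro!: le_SUP_of_sum[OF finite_hyps hyps_nonempty noisy, where C = 1] risk_le_1 sum)
  show "c \<le> rand_minimax m d"
    unfolding rand_minimax_def
  proof (rule cINF_greatest)
    have "(\<lambda>_ _. h) \<in> rand_learners m d" using h by (simp add: rand_learners_def)
    then show "rand_learners m d \<noteq> {}" by blast
  next
    fix L assume L: "L \<in> rand_learners m d"
    interpret U: prob_space unif by (rule prob_space_unif)
    have int: "integrable unif (\<lambda>u. risk m d (\<lambda>z. L z u) (noisy d b \<sigma>))" if "\<sigma> \<in> hyps d" for \<sigma>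
      using that by (intro rand_risk_eq_integral(2) L noisy_distrs d)
    \<comment> \<open>The bound on the sum over labellings is integrated over \<open>u\<close>
      before passing to the supremum; bounds on the supremum for each \<open>u\<close> would not
      suffice, because the bad distribution could depend on \<open>u\<close>.\<close>
    have "real (card (hyps d)) * c
        \<le> (LINT u|unif. (\<Sum>\<sigma>\<in>hyps d. risk m d (\<lambda>z. L z u) (noisy d b \<sigma>)))"
      by (intro U.integral_ge_const AE_I2 sum rand_learner_section[OF L] Bochner_Integration.integrable_sum int)
    also have "\<dots> = (\<Sum>\<sigma>\<in>hyps d. rand_risk m d L (noisy d b \<sigma>))"
      by (simp add: rand_risk_eq_integral(1)[OF L noisy_distrs[OF d]] Bochner_Integration.integral_sum int)
    finally show "c \<le> (SUP D\<in>distrs d. rand_risk m d L D)"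
      by (intro le_SUP_of_sum[OF finite_hyps hyps_nonempty noisy, where C = 1] rand_risk_le_1 L)
  qed
qed

section \<open>Evaluation of \<open>B1\<close> for \<nu> up to 1\<close>

lemma bayes_0: "bayes 0 b = 1 / 2"
  by (simp add: bayes_def sep_def V_pmf_def)

lemma bayes_1:
  assumes "0 \<le> b" "b \<le> 1"
  shows "bayes 1 b = (1 - b) / 2"
proof -
  have "measure_pmf.prob (V_pmf 1 c) {0<..} = (1 + c) / 2" if "-1 \<le> c" "c \<le> 1" for c
  proof -
    have "V_pmf 1 c = Y_pmf c"
      unfolding V_pmf_def replicate_pmf_1 by (simp add: pmf.map_comp o_def)
    then have "measure_pmf.prob (V_pmf 1 c) {0<..} = measure_pmf.expectation (Y_pmf c) (indicator {0<..})"
      by simp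
    also have "\<dots> = (1 + c) / 2"
      unfolding expectation_Y_pmf[OF that] by simp
    finally show ?thesis .
  qed
  from this[of b] this[of "-b"] show ?thesis
    using assms by (simp add: bayes_def sep_def field_simps)
qed

lemma bayes_interp_le_1:
  assumes "0 \<le> b" "b \<le> 1" "\<kappa> \<le> 1"
  shows "bayes_interp \<kappa> b = (1 - \<kappa> * b) / 2"
  unfolding bayes_interp_def bayes_0 bayes_1[OF assms(1,2)] using assms(3) by (simp add: field_simps)

lemma B1_eq_SUP:
  "\<nu> \<le> 1 \<Longrightarrow> B1 \<nu> = (SUP b\<in>{0<..<1}. b * ((1 - \<nu> * b) / 2))"
  unfolding B1_def by (intro SUP_cong) (auto simp: bayes_interp_le_1)

lemma cSUP_eqI:
  fixes f :: "'a \<Rightarrow> real"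
  assumes "\<And>x. x \<in> A \<Longrightarrow> f x \<le> c" "\<And>y. (\<And>x. x \<in> A \<Longrightarrow> f x \<le> y) \<Longrightarrow> c \<le> y" "A \<noteq> {}"
  shows "(SUP x\<in>A. f x) = c"
  using assms by (intro cSup_eq_non_empty) auto

text \<open>The vertex 1/(2 \<nu>) of the quadratic is at least 1, so the supremum over the open
  interval is the limit as b tends to 1 and is not attained.\<close>

lemma B1_small:
  assumes "0 < \<nu>" "\<nu> \<le> 1 / 2"
  shows "B1 \<nu> = (1 - \<nu>) / 2"
proof -
  define g :: "real \<Rightarrow> real" where "g b = b * ((1 - \<nu> * b) / 2)" for b
  have "(SUP b\<in>{0<..<1}. g b) = (1 - \<nu>) / 2"
  proof (rule cSUP_eqI)
    fix b :: real assume b: "b \<in> {0<..<1}"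
    \<comment> \<open>This product is twice the difference between the claimed supremum and
      \<open>g b\<close>.\<close>
    have "0 \<le> (1 - b) * (1 - \<nu> * (1 + b))"
    proof (rule mult_nonneg_nonneg)
      have "\<nu> * (1 + b) \<le> 1 / 2 * 2" using assms b by (intro mult_mono) auto
      then show "0 \<le> 1 - \<nu> * (1 + b)" by simp
    qed (use b in auto)
    then show "g b \<le> (1 - \<nu>) / 2" by (simp add: g_def field_simps)
  next
    fix y assume y: "\<And>b. b \<in> {0<..<1} \<Longrightarrow> g b \<le> y"
    have "(g \<longlongrightarrow> g 1) (at_left 1)"
      unfolding g_def by (intro tendsto_intros) simp_all
    moreover have "eventually (\<lambda>b. g b \<le> y) (at_left 1)"
      using eventually_at_left_real[of 0 1] by (rule eventually_mono) (auto intro: y)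
    ultimately have "g 1 \<le> y"
      by (intro tendsto_upperbound) auto
    then show "(1 - \<nu>) / 2 \<le> y" by (simp add: g_def)
  qed simp
  then show ?thesis using assms by (simp add: B1_eq_SUP g_def)
qed

text \<open>Here the vertex 1/(2 \<nu>) lies inside the interval and the supremum is attained there;
  the upper bound is a completed square.\<close>

lemma B1_large:
  assumes "1 / 2 < \<nu>" "\<nu> \<le> 1"
  shows "B1 \<nu> = 1 / (8 * \<nu>)"
proof -
  have "(SUP b\<in>{0<..<1}. b * ((1 - \<nu> * b) / 2)) = 1 / (8 * \<nu>)"
  proof (rule cSUP_eqI)
    fix b :: real assume "b \<in> {0<..<1}"
    have "0 \<le> (2 * \<nu> * b - 1)\<^sup>2" by simp
    then show "b * ((1 - \<nu> * b) / 2) \<le> 1 / (8 * \<nu>)"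
      using assms by (simp add: field_simps power2_eq_square)
  next
    fix y assume y: "\<And>b. b \<in> {0<..<1} \<Longrightarrow> b * ((1 - \<nu> * b) / 2) \<le> y"
    from y[of "1 / (2 * \<nu>)"] show "1 / (8 * \<nu>) \<le> y"
      using assms by (simp add: field_simps)
  qed simp
  then show ?thesis using assms by (simp add: B1_eq_SUP)
qed

section \<open>The choice of the bias b\<close>

theorem proposition2p13:
  fixes m d :: nat and \<nu> :: real
  assumes "m \<ge> 1" and "d \<ge> 1"
    and "\<nu> = real m / real d" and "0 < \<nu>" and "\<nu> \<le> 3"
  shows "minimax m d \<ge> B2_hat \<nu>
    \<and> rand_minimax m d \<ge> B2_hat \<nu>
    \<and> (\<nu> \<le> 1 / 2 \<longrightarrow> B1 \<nu> = (1 - \<nu>) / 2)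
    \<and> (1 / 2 \<le> \<nu> \<and> \<nu> \<le> 1 \<longrightarrow> B1 \<nu> = 1 / (8 * \<nu>))"
proof -
  have "B2_hat \<nu> \<le> c" if c: "c \<in> {minimax m d, rand_minimax m d}" for c
  proof (cases "\<nu> \<le> 1")
    case True
    \<comment> \<open>The majorant \<open>b * real k\<close> is used with every \<open>b\<close>,
      because \<open>B1\<close> is the supremum of the resulting bounds.\<close>
    have "b * ((1 - \<nu> * b) / 2) \<le> c" if "b \<in> {0<..<1}" for b
      using that c minimax_ge[of b d 0 b m] majority_le(1)[of b] assms
      by (auto simp: mult.commute)
    then have "B1 \<nu> \<le> c"
      unfolding B1_eq_SUP[OF True] by (intro cSUP_least) auto
    then show ?thesis using True by (simp add: B2_hat_def)
  next
    case False
    \<comment> \<open>This is 1/2 at \<nu> = 1, the exact optimum there, and 11/30 at \<nu> = 3,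
      close to the optimum (sqrt 3 - 1)/2 of the bound.\<close>
    define b where "b = (17 - 2 * \<nu>) / 30"
    define c' where "c' = (1 - b\<^sup>2) / 4"
    define \<beta> where "\<beta> = b * c'"
    have b: "0 \<le> b" "b < 1"
      using False assms(5) by (auto simp: b_def)
    have "majority b k \<le> (b - \<beta>) + \<beta> * real k" for k
      using majority_le(2)[of b k, folded c'_def] b by (simp add: \<beta>_def algebra_simps)
    then have "b * ((1 - ((b - \<beta>) + \<beta> * \<nu>)) / 2) \<le> c"
      using minimax_ge[OF b assms(2), of "b - \<beta>" \<beta> m] c assms(3) by auto
    moreover have "b * ((1 - ((b - \<beta>) + \<beta> * \<nu>)) / 2) = B2_hat \<nu>"
      using False by (simp add: B2_hat_def b_def \<beta>_def c'_def field_simps power2_eq_square power3_eq_cube power4_eq_xxxx)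
    ultimately show ?thesis by simp
  qed
  moreover have "B1 \<nu> = (1 - \<nu>) / 2" if "\<nu> \<le> 1 / 2"
    using that assms by (intro B1_small)
  moreover have "B1 \<nu> = 1 / (8 * \<nu>)" if "1 / 2 \<le> \<nu>" "\<nu> \<le> 1"
  \<comment> \<open>At \<nu> = 1/2 the vertex sits at the excluded endpoint b = 1; both formulas
    give 1/4.\<close>
  proof (cases "\<nu> = 1 / 2")
    case True
    show ?thesis unfolding True using B1_small[of "1 / 2"] by simp
  next
    case False
    then show ?thesis using that by (intro B1_large) auto
  qed
  ultimately show ?thesis by auto
qed

end
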